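(* Let $X$ be a nonempty set and $Y$ a nonempty subset of $X$. The semigroup $\overline{\Omega}(X,Y)$ is unit-regular if and only if $X$ is finite.
   Context: $T(X)$ is the semigroup of all maps $X\to X$ under composition; maps are written on the right and composed from left to right, so $x(fg)=(xf)g$, and $Yf=\{yf\colon y\in Y\}$. Let $\overline{\Omega}(X,Y)=\{f\in T(X)\colon Yf=Y\}$, a subsemigroup of $T(X)$ containing the identity map. A semigroup $S$ with identity is unit-regular if for every $a\in S$ there exists a unit $b$ of $S$ with $aba=a$. *)

theory Defs
  imports "HOL-Algebra.Group" "HOL-Library.FuncSet"
begin

text \<open>
  Maps \<open>X \<rightarrow> X\<close> are represented by extensional functions, so that distinct elements of
  \<open>X \<rightarrow>\<^sub>E X\<close> are distinct maps on \<open>X\<close>. Maps are composed from left to right,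
  \<open>x (f g) = (x f) g\<close>, whence the swapped arguments of \<open>compose\<close>.
\<close>

definition full_transf :: "'a set \<Rightarrow> ('a \<Rightarrow> 'a) monoid" where
  "full_transf X =
    \<lparr>carrier = X \<rightarrow>\<^sub>E X, mult = (\<lambda>f g. compose X g f), one = (\<lambda>x\<in>X. x)\<rparr>"

definition Omega_bar :: "'a set \<Rightarrow> 'a set \<Rightarrow> ('a \<Rightarrow> 'a) monoid" where
  "Omega_bar X Y =
    (full_transf X)\<lparr>carrier := {f \<in> carrier (full_transf X). f ` Y = Y}\<rparr>"

definition unit_regular :: "('a, 'b) monoid_scheme \<Rightarrow> bool" where
  "unit_regular S \<longleftrightarrow> monoid S \<and>
    (\<forall>a\<in>carrier S. \<exists>b\<in>Units S. a \<otimes>\<^bsub>S\<^esub> b \<otimes>\<^bsub>S\<^esub> a = a)"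

lemma monoid_full_transf: "monoid (full_transf X)"
proof (rule monoidI)
  fix f g h
  assume "f \<in> carrier (full_transf X)" "g \<in> carrier (full_transf X)"
    "h \<in> carrier (full_transf X)"
  then show "f \<otimes>\<^bsub>full_transf X\<^esub> g \<otimes>\<^bsub>full_transf X\<^esub> h =
      f \<otimes>\<^bsub>full_transf X\<^esub> (g \<otimes>\<^bsub>full_transf X\<^esub> h)"
    by (auto simp: full_transf_def compose_def fun_eq_iff)
qed (auto simp: full_transf_def compose_def fun_eq_iff PiE_def extensional_def Pi_def)

lemma submonoid_Omega_bar:
  assumes "Y \<subseteq> X"
  shows "submonoid (carrier (Omega_bar X Y)) (full_transf X)"
proof
  fix f g
  assume fg: "f \<in> carrier (Omega_bar X Y)" "g \<in> carrier (Omega_bar X Y)"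
  have "compose X g f ` Y = g ` (f ` Y)"
    using assms by (force simp: compose_def)
  with fg show "f \<otimes>\<^bsub>full_transf X\<^esub> g \<in> carrier (Omega_bar X Y)"
    by (auto simp: Omega_bar_def full_transf_def compose_def)
next
  show "\<one>\<^bsub>full_transf X\<^esub> \<in> carrier (Omega_bar X Y)"
    using assms by (force simp: Omega_bar_def full_transf_def)
qed (auto simp: Omega_bar_def)

lemma monoid_Omega_bar: "Y \<subseteq> X \<Longrightarrow> monoid (Omega_bar X Y)"
  using submonoid.submonoid_is_monoid[OF submonoid_Omega_bar monoid_full_transf]
  by (simp add: Omega_bar_def)

end

theory Submission
  imports Defs
begin

text \<open>
  The units of \<open>Omega_bar X Y\<close> are the permutations of \<open>X\<close> that map \<open>Y\<close> onto itself.
  If \<open>b\<close> is such a permutation and \<open>a b a = a\<close>, then one-sided cancellation shows that an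
  injective or surjective \<open>a\<close> is the inverse of \<open>b\<close>
  (\<open>unit_regular_inj_or_surj_imp_bij\<close>). Hence unit-regularity forbids elements that have
  exactly one of these two properties.

  If \<open>X\<close> is infinite, then so is \<open>Y\<close> or \<open>X - Y\<close>, and either case yields a forbidden element.
  The condition \<open>Y f = Y\<close> excludes a non-surjective self-map of \<open>Y\<close>, but not a non-injective
  one, so an infinite \<open>Y\<close> gives a surjection of \<open>X\<close> that is not injective; on \<open>X - Y\<close> there is
  no condition, and an infinite \<open>X - Y\<close> gives an injection of \<open>X\<close> that is not surjective.

  If \<open>X\<close> is finite, then \<open>a\<close> permutes \<open>Y\<close>. A section of \<open>a\<close> on its image that inverts this
  permutation on \<open>Y\<close> is injective, and by counting it extends to a permutation of \<open>X\<close>; this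
  is the required unit (\<open>finite_permutation_pseudo_inverse\<close>).
\<close>

lemma carrier_Omega_bar: "carrier (Omega_bar X Y) = {f \<in> X \<rightarrow>\<^sub>E X. f ` Y = Y}"
  by (simp add: Omega_bar_def full_transf_def)

lemma mult_Omega_bar: "f \<otimes>\<^bsub>Omega_bar X Y\<^esub> g = compose X g f"
  by (simp add: Omega_bar_def full_transf_def)

lemma one_Omega_bar: "\<one>\<^bsub>Omega_bar X Y\<^esub> = (\<lambda>x\<in>X. x)"
  by (simp add: Omega_bar_def full_transf_def)

lemma Units_Omega_bar:
  assumes "Y \<subseteq> X"
  shows "Units (Omega_bar X Y) = {b \<in> carrier (Omega_bar X Y). bij_betw b X X}"
proof (intro equalityI subsetI)
  fix b assume "b \<in> Units (Omega_bar X Y)"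
  then obtain c where b: "b \<in> carrier (Omega_bar X Y)" and c: "c \<in> carrier (Omega_bar X Y)"
    and cb: "compose X b c = (\<lambda>x\<in>X. x)" and bc: "compose X c b = (\<lambda>x\<in>X. x)"
    by (auto simp: Units_def mult_Omega_bar one_Omega_bar)
  have "b (c x) = x" "c (b x) = x" if "x \<in> X" for x
    using that fun_cong[OF cb, of x] fun_cong[OF bc, of x] by (simp_all add: compose_def)
  then have "bij_betw b X X"
    using b c by (intro bij_betw_byWitness[where f' = c]) (auto simp: carrier_Omega_bar)
  with b show "b \<in> {b \<in> carrier (Omega_bar X Y). bij_betw b X X}" by simp
next
  fix b assume "b \<in> {b \<in> carrier (Omega_bar X Y). bij_betw b X X}"
  then have b: "b \<in> carrier (Omega_bar X Y)" and bY: "b ` Y = Y" and bij: "bij_betw b X X"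
    by (auto simp: carrier_Omega_bar)
  define c where "c = restrict (inv_into X b) X"
  have "inv_into X b ` (b ` Y) = Y"
    using assms bij by (simp add: bij_betw_def inv_into_image_cancel)
  moreover have "c ` Y = inv_into X b ` Y"
    using assms unfolding c_def by (intro image_cong) auto
  ultimately have "c ` Y = Y" using bY by simp
  moreover have "c \<in> X \<rightarrow>\<^sub>E X"
    using bij_betw_imp_funcset[OF bij_betw_inv_into[OF bij]] by (simp add: c_def)
  ultimately have c: "c \<in> carrier (Omega_bar X Y)" by (simp add: carrier_Omega_bar)
  have "compose X b c = (\<lambda>x\<in>X. x)" "compose X c b = (\<lambda>x\<in>X. x)"
    using bij_betw_inv_into_left[OF bij] bij_betw_inv_into_right[OF bij] bij_betwE[OF bij]
    by (simp_all add: c_def compose_def cong: restrict_cong)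
  with b c show "b \<in> Units (Omega_bar X Y)"
    by (auto simp: Units_def mult_Omega_bar one_Omega_bar)
qed

lemma unit_regular_Omega_bar_iff:
  assumes "Y \<subseteq> X"
  shows "unit_regular (Omega_bar X Y) \<longleftrightarrow>
    (\<forall>a\<in>carrier (Omega_bar X Y). \<exists>b\<in>carrier (Omega_bar X Y).
      bij_betw b X X \<and> (\<forall>x\<in>X. a (b (a x)) = a x))"
proof -
  have "a \<otimes>\<^bsub>Omega_bar X Y\<^esub> b \<otimes>\<^bsub>Omega_bar X Y\<^esub> a = a \<longleftrightarrow> (\<forall>x\<in>X. a (b (a x)) = a x)"
    if "a \<in> carrier (Omega_bar X Y)" for a b
    using that
    by (auto simp: mult_Omega_bar carrier_Omega_bar compose_def fun_eq_iff PiE_def extensional_def)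
  then show ?thesis
    using assms by (simp add: unit_regular_def monoid_Omega_bar Units_Omega_bar Bex_def conj_assoc)
qed

text \<open>
  From \<open>a b a = a\<close>, cancelling an injective \<open>a\<close> on the right leaves \<open>a b = 1\<close>, and cancelling
  a surjective \<open>a\<close> on the left leaves \<open>b a = 1\<close>; as \<open>b\<close> is invertible, \<open>a\<close> is its inverse.
\<close>

lemma unit_regular_inj_or_surj_imp_bij:
  assumes "Y \<subseteq> X" and "unit_regular (Omega_bar X Y)" and "a \<in> carrier (Omega_bar X Y)"
    and "inj_on a X \<or> a ` X = X"
  shows "bij_betw a X X"
proof -
  obtain b where b: "bij_betw b X X" and aba: "\<And>x. x \<in> X \<Longrightarrow> a (b (a x)) = a x"
    using assms(2,3) unfolding unit_regular_Omega_bar_iff[OF assms(1)] by blast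
  have aX: "a x \<in> X" if "x \<in> X" for x
    using assms(3) that by (auto simp: carrier_Omega_bar)
  have bX: "b x \<in> X" if "x \<in> X" for x
    using b that by (auto simp: bij_betw_def)
  have "(\<forall>x\<in>X. b (a x) = x) \<or> (\<forall>y\<in>X. a (b y) = y)"
    using assms(4)
  proof
    assume "inj_on a X"
    then have "b (a x) = x" if "x \<in> X" for x
      using aba[OF that] bX[OF aX[OF that]] that by (rule inj_onD)
    then show ?thesis by blast
  next
    assume "a ` X = X"
    then have "a (b y) = y" if "y \<in> X" for y
      using that aba by (metis imageE)
    then show ?thesis by blast
  qed
  moreover have "a (b y) = y" if ba: "\<forall>x\<in>X. b (a x) = x" and y: "y \<in> X" for y
  proof (rule inj_onD)
    show "inj_on b X" using b by (rule bij_betw_imp_inj_on)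
    show "b (a (b y)) = b y" using ba bX[OF y] by blast
  qed (use aX bX y in blast)+
  moreover have "b (a x) = x" if ab: "\<forall>y\<in>X. a (b y) = y" and x: "x \<in> X" for x
  proof -
    obtain u where "u \<in> X" "x = b u"
      using x bij_betw_imp_surj_on[OF b] by blast
    with ab show ?thesis by simp
  qed
  ultimately have "\<forall>x\<in>X. b (a x) = x" "\<forall>y\<in>X. a (b y) = y" by blast+
  then show ?thesis
    using aX bX by (intro bij_betw_byWitness[where f' = b]) blast+
qed

lemma infinite_inj_not_surj:
  assumes "infinite A"
  obtains g where "g ` A \<subseteq> A" "inj_on g A" "g ` A \<noteq> A"
proof -
  obtain a where "a \<in> A" using assms by fastforce
  moreover obtain g where "bij_betw g A (A - {a})"
    using infinite_imp_bij_betw[OF assms] by blast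
  ultimately show ?thesis
    by (intro that[of g]) (auto simp: bij_betw_def)
qed

lemma infinite_surj_not_inj:
  assumes "infinite A"
  obtains g where "g ` A = A" "\<not> inj_on g A"
proof -
  obtain h where h: "h ` A \<subseteq> A" "inj_on h A" "h ` A \<noteq> A"
    using infinite_inj_not_surj[OF assms] .
  then obtain a where a: "a \<in> A" "a \<notin> h ` A" by blast
  \<comment> \<open>A left inverse of \<open>h\<close> that sends the points missed by \<open>h\<close> to \<open>a\<close>; then \<open>a\<close> and \<open>h a\<close> both
    go to \<open>a\<close>.\<close>
  define g where "g x = (if x \<in> h ` A then inv_into A h x else a)" for x
  have gh: "g (h x) = x" if "x \<in> A" for x
    using that h by (simp add: g_def)
  have gA: "g ` A \<subseteq> A"
    using a by (auto simp: g_def intro: inv_into_into)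
  show ?thesis
  proof (rule that[of g])
    have "x \<in> g ` A" if "x \<in> A" for x
      using gh[OF that] h(1) that by (intro image_eqI[of _ _ "h x"]) auto
    with gA show "g ` A = A" by blast
    have "h a \<in> A" "h a \<noteq> a" using a h(1) by (blast, metis imageI)
    moreover have "g (h a) = g a" using gh[OF a(1)] a(2) by (simp add: g_def)
    ultimately show "\<not> inj_on g A" using a(1) by (meson inj_onD)
  qed
qed

text \<open>
  The complement of \<open>A\<close> is fixed pointwise and not hit from \<open>A\<close>, so any defect of injectivity
  or surjectivity is that of \<open>g\<close>. This places such a defect within \<open>Y\<close> or within \<open>X - Y\<close>.
\<close>

lemma extend_by_identity:
  fixes g :: "'a \<Rightarrow> 'a"
  assumes "A \<subseteq> X" and "g ` A \<subseteq> A"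
  defines "f \<equiv> (\<lambda>x\<in>X. if x \<in> A then g x else x)"
  shows "f \<in> X \<rightarrow>\<^sub>E X" and "inj_on f X \<longleftrightarrow> inj_on g A" and "f ` X = X \<longleftrightarrow> g ` A = A"
proof -
  show "f \<in> X \<rightarrow>\<^sub>E X" using assms(1,2) by (force simp: f_def)
  show "inj_on f X \<longleftrightarrow> inj_on g A"
    using assms(1,2) unfolding f_def inj_on_def by (auto split: if_splits) blast+
  have "f ` X = g ` A \<union> (X - A)"
    using assms(1) by (force simp: f_def)
  then show "f ` X = X \<longleftrightarrow> g ` A = A" using assms(1,2) by blast
qed

lemma unit_regular_imp_finite:
  assumes YX: "Y \<subseteq> X" and ur: "unit_regular (Omega_bar X Y)"
  shows "finite X"
proof (rule ccontr)
  assume "infinite X"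
  then consider "infinite Y" | "infinite (X - Y)"
    using YX by (metis Diff_infinite_finite)
  then show False
  proof cases
    case 1
    obtain g where g: "g ` Y = Y" "\<not> inj_on g Y" using infinite_surj_not_inj[OF 1] .
    define f where "f = (\<lambda>x\<in>X. if x \<in> Y then g x else x)"
    have f: "f \<in> X \<rightarrow>\<^sub>E X" "\<not> inj_on f X" "f ` X = X"
      using extend_by_identity[OF YX, of g] g by (simp_all add: f_def)
    moreover have "f ` Y = g ` Y"
      using YX by (intro image_cong) (auto simp: f_def)
    ultimately have "bij_betw f X X"
      using unit_regular_inj_or_surj_imp_bij[OF YX ur, of f] g(1) by (simp add: carrier_Omega_bar)
    with f show False by (simp add: bij_betw_def)
  next
    case 2
    obtain g where g: "g ` (X - Y) \<subseteq> X - Y" "inj_on g (X - Y)" "g ` (X - Y) \<noteq> X - Y"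
      using infinite_inj_not_surj[OF 2] .
    define f where "f = (\<lambda>x\<in>X. if x \<in> X - Y then g x else x)"
    have f: "f \<in> X \<rightarrow>\<^sub>E X" "inj_on f X" "f ` X \<noteq> X"
      using extend_by_identity[OF Diff_subset g(1)] g unfolding f_def by blast+
    moreover have "f ` Y = id ` Y"
      using YX by (intro image_cong) (auto simp: f_def)
    ultimately have "bij_betw f X X"
      using unit_regular_inj_or_surj_imp_bij[OF YX ur, of f] by (simp add: carrier_Omega_bar)
    with f show False by (simp add: bij_betw_def)
  qed
qed

text \<open>
  A section of \<open>a\<close> on its image is injective, and since \<open>X\<close> is finite, the complements of
  its domain and of its range have the same size; any bijection between them completes it to \<open>b\<close>.
\<close>

lemma finite_permutation_pseudo_inverse:
  assumes fin: "finite X" and YX: "Y \<subseteq> X" and aX: "a ` X \<subseteq> X" and aY: "a ` Y = Y"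
  obtains b where "b \<in> X \<rightarrow>\<^sub>E X" "bij_betw b X X" "b ` Y = Y" "\<And>x. x \<in> X \<Longrightarrow> a (b (a x)) = a x"
proof -
  \<comment> \<open>Points of \<open>Y\<close> may also have preimages outside \<open>Y\<close>, so the section must choose its values on
    \<open>Y\<close> within \<open>Y\<close>.\<close>
  define r where "r z = inv_into (if z \<in> Y then Y else X) a z" for z
  have Ya: "Y \<subseteq> a ` X" using YX aY by blast
  have ar: "a (r z) = z" if "z \<in> a ` X" for z
    using that aY by (simp add: r_def f_inv_into_f)
  have rX: "r z \<in> X" if "z \<in> a ` X" for z
    using that aY YX inv_into_into[of z a Y] inv_into_into[of z a X] by (auto simp: r_def)
  have r_inj: "inj_on r (a ` X)" using ar by (metis inj_onI)
  have "r ` Y \<subseteq> Y" using aY inv_into_into[of _ a Y] by (auto simp: r_def)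
  then have rY: "r ` Y = Y"
    using inj_on_subset[OF r_inj Ya] fin YX by (metis endo_inj_surj finite_subset)
  have rsub: "r ` a ` X \<subseteq> X" using rX by blast
  have "card (X - a ` X) = card (X - r ` a ` X)"
    using fin aX rsub by (simp add: card_Diff_subset card_image[OF r_inj])
  then obtain c where c: "bij_betw c (X - a ` X) (X - r ` a ` X)"
    using fin finite_same_card_bij by (metis finite_Diff)
  define b where "b = (\<lambda>z\<in>X. if z \<in> a ` X then r z else c z)"
  have br: "b z = r z" if "z \<in> a ` X" for z
    using that aX by (auto simp: b_def)
  have "bij_betw b (a ` X) (r ` a ` X)"
    using r_inj br by (simp add: bij_betw_def cong: inj_on_cong image_cong)
  moreover have "bij_betw b (X - a ` X) (X - r ` a ` X)"
    using c by (rule bij_betw_cong[THEN iffD1, rotated]) (simp add: b_def)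
  ultimately have "bij_betw b (a ` X \<union> (X - a ` X)) (r ` a ` X \<union> (X - r ` a ` X))"
    by (rule bij_betw_combine) blast
  then have bij: "bij_betw b X X"
    using aX rsub by (simp add: Un_absorb1)
  show ?thesis
  proof (rule that[OF _ bij])
    show "b \<in> X \<rightarrow>\<^sub>E X"
      using bij_betw_imp_funcset[OF bij] by (simp add: b_def PiE_def)
    have "b ` Y = r ` Y" using br Ya by (intro image_cong) auto
    then show "b ` Y = Y" using rY by simp
    show "a (b (a x)) = a x" if "x \<in> X" for x
      using that br ar by simp
  qed
qed

theorem theorem3p9:
  fixes X Y :: "'a set"
  assumes "X \<noteq> {}" and "Y \<noteq> {}" and "Y \<subseteq> X"
  shows "unit_regular (Omega_bar X Y) \<longleftrightarrow> finite X"
proof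
  assume "unit_regular (Omega_bar X Y)"
  with \<open>Y \<subseteq> X\<close> show "finite X" by (rule unit_regular_imp_finite)
next
  assume fin: "finite X"
  show "unit_regular (Omega_bar X Y)"
    unfolding unit_regular_Omega_bar_iff[OF \<open>Y \<subseteq> X\<close>]
  proof
    fix a assume "a \<in> carrier (Omega_bar X Y)"
    then have "a ` X \<subseteq> X" "a ` Y = Y" by (auto simp: carrier_Omega_bar)
    then obtain b where "b \<in> X \<rightarrow>\<^sub>E X" "bij_betw b X X" "b ` Y = Y"
      "\<And>x. x \<in> X \<Longrightarrow> a (b (a x)) = a x"
      using finite_permutation_pseudo_inverse[OF fin \<open>Y \<subseteq> X\<close>] by metis
    then show "\<exists>b\<in>carrier (Omega_bar X Y). bij_betw b X X \<and> (\<forall>x\<in>X. a (b (a x)) = a x)"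
      by (auto simp: carrier_Omega_bar)
  qed
qed

end
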